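(* Let $D$ be a binary delta-matroid on a finite set $E$ and let $Z=Z_3(D,\tau)$ with $\tau=(T_1,T_2,T_3)$. For a circuit $C$ of $Z$ put $p_3(C)=|C\cap T_3|\bmod 2$. Then $D$ is even if and only if $p_3(C)=0$ for every circuit $C$ of $Z$.
   Context: All sets are finite; $\triangle$ is symmetric difference. Delta-matroids. A set system is a pair $(E,\mathcal F)$ with $\mathcal F\subseteq 2^E$ (the feasible sets). A delta-matroid is a set system $D=(E,\mathcal F)$ with $\mathcal F\ne\varnothing$ such that for all $X,Y\in\mathcal F$ and $u\in X\triangle Y$ there is $v\in X\triangle Y$ (possibly $v=u$) with $X\triangle\{u,v\}\in\mathcal F$. $D$ is even if all feasible sets have the same parity of cardinality. Twist: $D*X=(E,\{F\triangle X:F\in\mathcal F\})$ for $X\subseteq E$. For a symmetric matrix $A$ over $\mathbb F_2$ indexed by $E$, $D(A)=(E,\{X\subseteq E: A[X]\text{ nonsingular}\})$, where $A[X]$ is the principal submatrix and the empty matrix is nonsingular. $D$ is binary if some twist of $D$ is isomorphic to some such $D(A)$. Multimatroids. A carrier $(U,\Omega)$ is a set $U$ with a partition $\Omega$ into skew classes. A subtransversal (transversal) meets each skew class in at most (exactly) one element. A multimatroid $Z=(U,\Omega,\mathcal I)$ has $\mathcal I$ a family of subtransversals (independent sets) such that (1) for each transversal $T$, $\mathcal I\cap 2^T$ is the family of independent sets of a matroid on $T$; (2) for every $I\in\mathcal I$ and every two distinct elements $x,y$ of one skew class disjoint from $I$, $I\cup\{x\}\in\mathcal I$ or $I\cup\{y\}\in\mathcal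 I$. Bases are the maximal independent sets; circuits are the minimal subtransversals that are not independent. For $X\subseteq U$, $Z-X$ is the multimatroid on $U\setminus X$, with skew classes the nonempty sets $\omega\setminus X$, whose independent sets are those of $Z$ contained in $U\setminus X$. A $3$-matroid is a multimatroid all of whose skew classes have size $3$; it is tight if for every basis $X$ and skew class $\omega$, exactly one of the transversals $(X\setminus\omega)\cup\{u\}$, $u\in\omega$, is not a basis. The tight $3$-matroid $Z_3(D,\tau)$. For each $e\in E$ let $\omega_e=\{e_1,e_2,e_3\}$ (pairwise disjoint), $U=\bigcup_e\omega_e$, $\Omega=\{\omega_e:e\in E\}$, $T_i=\{e_i:e\in E\}$, $\tau=(T_1,T_2,T_3)$. For a tight $3$-matroid $Z$ on $(U,\Omega)$, $D_{Z,\tau}$ is the set system on $E$ in which $X$ is feasible iff $\{e_1:e\in E\setminus X\}\cup\{e_2:e\in X\}$ is a basis of $Z-T_3$. For a binary delta-matroid $D$ it is known that there is a unique tight $3$-matroid $Z$ on $(U,\Omega)$ with $D=D_{Z,\tau}$; it is denoted $Z_3(D,\tau)$. *)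

theory Defs
  imports
    "HOL-Library.Z2"
    "HOL-Library.Disjoint_Sets"
    "Jordan_Normal_Form.Determinant"
    "Jordan_Normal_Form.DL_Submatrix"
begin

record 'a set_system =
  ground :: "'a set"
  feasible :: "'a set set"

definition delta_matroid :: "'a set_system \<Rightarrow> bool" where
  "delta_matroid D \<longleftrightarrow>
     finite (ground D) \<and> feasible D \<subseteq> Pow (ground D) \<and> feasible D \<noteq> {} \<and>
     (\<forall>X\<in>feasible D. \<forall>Y\<in>feasible D. \<forall>u\<in>sym_diff X Y.
        \<exists>v\<in>sym_diff X Y. sym_diff X {u, v} \<in> feasible D)"

definition even_set_system :: "'a set_system \<Rightarrow> bool" where
  "even_set_system D \<longleftrightarrow>
     (\<forall>X\<in>feasible D. \<forall>Y\<in>feasible D. even (card X) \<longleftrightarrow> even (card Y))"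

definition twist :: "'a set_system \<Rightarrow> 'a set \<Rightarrow> 'a set_system" where
  "twist D X = \<lparr>ground = ground D, feasible = (\<lambda>F. sym_diff F X) ` feasible D\<rparr>"

definition set_system_iso :: "'a set_system \<Rightarrow> 'b set_system \<Rightarrow> bool" where
  "set_system_iso D D' \<longleftrightarrow>
     (\<exists>f. bij_betw f (ground D) (ground D') \<and> feasible D' = (\<lambda>F. f ` F) ` feasible D)"

text \<open>
  A matrix of the library has rows and columns indexed by \<open>{0..<n}\<close>; other finite index sets are
  covered because binary delta-matroids are defined up to isomorphism.  The determinant of the
  empty matrix is 1, so the empty set is feasible.
\<close>
definition delta_matroid_of_mat :: "bit mat \<Rightarrow> nat set_system" where
  "delta_matroid_of_mat A =
     \<lparr>ground = {0..<dim_row A},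
      feasible = {X. X \<subseteq> {0..<dim_row A} \<and> det (submatrix A X X) \<noteq> 0}\<rparr>"

definition binary_delta_matroid :: "'a set_system \<Rightarrow> bool" where
  "binary_delta_matroid D \<longleftrightarrow>
     delta_matroid D \<and>
     (\<exists>X n (A :: bit mat). X \<subseteq> ground D \<and> A \<in> carrier_mat n n \<and> transpose_mat A = A \<and>
        set_system_iso (twist D X) (delta_matroid_of_mat A))"

record 'u multimatroid =
  elements :: "'u set"
  skew_classes :: "'u set set"
  indep :: "'u set set"

definition subtransversal :: "'u multimatroid \<Rightarrow> 'u set \<Rightarrow> bool" where
  "subtransversal Z S \<longleftrightarrow> S \<subseteq> elements Z \<and> (\<forall>\<omega>\<in>skew_classes Z. card (S \<inter> \<omega>) \<le> 1)"

definition transversal :: "'u multimatroid \<Rightarrow> 'u set \<Rightarrow> bool" where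
  "transversal Z T \<longleftrightarrow> T \<subseteq> elements Z \<and> (\<forall>\<omega>\<in>skew_classes Z. card (T \<inter> \<omega>) = 1)"

definition matroid_on :: "'u set \<Rightarrow> 'u set set \<Rightarrow> bool" where
  "matroid_on T \<I> \<longleftrightarrow>
     finite T \<and> \<I> \<subseteq> Pow T \<and> {} \<in> \<I> \<and>
     (\<forall>I\<in>\<I>. \<forall>J. J \<subseteq> I \<longrightarrow> J \<in> \<I>) \<and>
     (\<forall>I\<in>\<I>. \<forall>J\<in>\<I>. card I < card J \<longrightarrow> (\<exists>x\<in>J - I. insert x I \<in> \<I>))"

definition is_multimatroid :: "'u multimatroid \<Rightarrow> bool" where
  "is_multimatroid Z \<longleftrightarrow>
     finite (elements Z) \<and> partition_on (elements Z) (skew_classes Z) \<and>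
     (\<forall>I\<in>indep Z. subtransversal Z I) \<and>
     (\<forall>T. transversal Z T \<longrightarrow> matroid_on T (indep Z \<inter> Pow T)) \<and>
     (\<forall>I\<in>indep Z. \<forall>\<omega>\<in>skew_classes Z. \<forall>x\<in>\<omega>. \<forall>y\<in>\<omega>. \<omega> \<inter> I = {} \<longrightarrow> x \<noteq> y \<longrightarrow>
        insert x I \<in> indep Z \<or> insert y I \<in> indep Z)"

definition basis :: "'u multimatroid \<Rightarrow> 'u set \<Rightarrow> bool" where
  "basis Z B \<longleftrightarrow> B \<in> indep Z \<and> (\<forall>I\<in>indep Z. B \<subseteq> I \<longrightarrow> I = B)"

definition circuit :: "'u multimatroid \<Rightarrow> 'u set \<Rightarrow> bool" where
  "circuit Z C \<longleftrightarrow> subtransversal Z C \<and> C \<notin> indep Z \<and>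
     (\<forall>C'. C' \<subset> C \<longrightarrow> subtransversal Z C' \<longrightarrow> C' \<in> indep Z)"

definition delete :: "'u multimatroid \<Rightarrow> 'u set \<Rightarrow> 'u multimatroid" where
  "delete Z X =
     \<lparr>elements = elements Z - X,
      skew_classes = {\<omega> - X | \<omega>. \<omega> \<in> skew_classes Z \<and> \<omega> - X \<noteq> {}},
      indep = {I \<in> indep Z. I \<subseteq> elements Z - X}\<rparr>"

definition three_matroid :: "'u multimatroid \<Rightarrow> bool" where
  "three_matroid Z \<longleftrightarrow> is_multimatroid Z \<and> (\<forall>\<omega>\<in>skew_classes Z. card \<omega> = 3)"

definition tight_three_matroid :: "'u multimatroid \<Rightarrow> bool" where
  "tight_three_matroid Z \<longleftrightarrow> three_matroid Z \<and>
     (\<forall>X. basis Z X \<longrightarrow> (\<forall>\<omega>\<in>skew_classes Z. \<exists>!u. u \<in> \<omega> \<and> \<not> basis Z (insert u (X - \<omega>))))"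

text \<open>
  The elements \<open>e\<^sub>1, e\<^sub>2, e\<^sub>3\<close> are written \<open>el e 1\<close>, \<open>el e 2\<close>, \<open>el e 3\<close>; the function \<open>el\<close> carries
  the data \<open>\<tau> = (T\<^sub>1, T\<^sub>2, T\<^sub>3)\<close>.
\<close>
definition labelling :: "'a set \<Rightarrow> ('a \<Rightarrow> nat \<Rightarrow> 'u) \<Rightarrow> bool" where
  "labelling E el \<longleftrightarrow> inj_on (\<lambda>(e, i). el e i) (E \<times> {1, 2, 3})"

definition skew_class :: "('a \<Rightarrow> nat \<Rightarrow> 'u) \<Rightarrow> 'a \<Rightarrow> 'u set" where
  "skew_class el e = {el e 1, el e 2, el e 3}"

definition tau :: "'a set \<Rightarrow> ('a \<Rightarrow> nat \<Rightarrow> 'u) \<Rightarrow> nat \<Rightarrow> 'u set" where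
  "tau E el i = {el e i | e. e \<in> E}"

definition set_system_of :: "'a set \<Rightarrow> ('a \<Rightarrow> nat \<Rightarrow> 'u) \<Rightarrow> 'u multimatroid \<Rightarrow> 'a set_system" where
  "set_system_of E el Z =
     \<lparr>ground = E,
      feasible = {X. X \<subseteq> E \<and>
        basis (delete Z (tau E el 3)) ({el e 1 | e. e \<in> E - X} \<union> {el e 2 | e. e \<in> X})}\<rparr>"

text \<open>
  \<open>is_Z3 D el Z\<close> is the defining property of \<open>Z\<^sub>3(D, \<tau>)\<close>.  It determines \<open>Z\<close>: by tightness the
  number of bases among the three transversals that differ only on a given skew class is 0 or 2,
  so the bases avoiding \<open>T\<^sub>3\<close> determine all bases.
\<close>
definition is_Z3 :: "'a set_system \<Rightarrow> ('a \<Rightarrow> nat \<Rightarrow> 'u) \<Rightarrow> 'u multimatroid \<Rightarrow> bool" where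
  "is_Z3 D el Z \<longleftrightarrow>
     elements Z = (\<Union>e\<in>ground D. skew_class el e) \<and>
     skew_classes Z = skew_class el ` ground D \<and>
     tight_three_matroid Z \<and>
     D = set_system_of (ground D) el Z"

definition p3 :: "'a set \<Rightarrow> ('a \<Rightarrow> nat \<Rightarrow> 'u) \<Rightarrow> 'u set \<Rightarrow> nat" where
  "p3 E el C = card (C \<inter> tau E el 3) mod 2"

end

theory Submission
  imports Defs
begin

text \<open>
  A subtransversal of \<open>Z\<close> is encoded by a label function \<open>s\<close> on \<open>E\<close>: the value \<open>s e = i\<close> with
  \<open>i\<close> in \<open>{1, 2, 3}\<close> says that \<open>el e i\<close> is selected, and \<open>s e = 0\<close> that nothing is selected in the
  class of \<open>e\<close>.  Reading \<open>0, 1, 2, 3\<close> as the vectors \<open>00, 10, 01, 11\<close> of the plane over the field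
  with two elements, label functions become vectors, and the third element of a skew class is the
  sum of the other two.

  One direction rests on tightness.  A delta-matroid that is not even has two feasible sets \<open>F\<close>
  and \<open>F \<union> {u}\<close>.  The two corresponding bases differ only in the class of \<open>u\<close>, so by tightness the
  third choice, \<open>el u 3\<close>, gives a dependent transversal.  It contains a circuit, and that circuit
  must use \<open>el u 3\<close>, its only element in \<open>T\<^sub>3\<close>: an odd circuit
  (\<open>odd_circuit_if_not_even\<close>).

  For the other direction, binarity gives a symmetric matrix \<open>A\<close> and a set \<open>X\<close> such that \<open>F\<close> is
  feasible exactly when \<open>A[F \<triangle> X]\<close> is nonsingular.  The vectors \<open>(A y, y)\<close>, with the two coordinates
  exchanged on \<open>X\<close>, are the linear relations between the columns of \<open>(I | A | I + A)\<close> that use at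
  most one column from each skew class.  Symmetry of \<open>A\<close> makes this space isotropic for the
  symplectic form, and its dimension is \<open>|E|\<close>.  These two properties imply that among three
  transversals differing in one class, the number of those containing no nonzero relation is zero
  or two (\<open>relation_free_third\<close>).  Tightness says the same about the bases of \<open>Z\<close>.  The two
  families agree on the transversals avoiding \<open>T\<^sub>3\<close>, hence everywhere
  (\<open>transversals_determined\<close>), and therefore every circuit of \<open>Z\<close> is the support of a relation
  \<open>(A y, y)\<close> (\<open>circuit_in_isotropic_system\<close>).

  Its elements in \<open>T\<^sub>3\<close> sit at the positions where both coordinates are \<open>1\<close>, also after the
  exchange on \<open>X\<close>, so their number modulo \<open>2\<close> is the quadratic form \<open>y\<^sup>T A y\<close>.  If \<open>D\<close> is even, the
  singletons are infeasible in the twist of \<open>D\<close> by \<open>X\<close>, so \<open>A\<close> has zero diagonal; a symmetric matrix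
  with zero diagonal over a field of characteristic two has vanishing quadratic form.
\<close>

section \<open>Label functions\<close>

text \<open>
  The independent sets of \<open>Z\<close> and the label functions above no relation are both compared through
  transversals.  Filling the empty classes one at a time makes that possible for either family.
\<close>
lemma extend_to_transversal:
  fixes P :: "('a \<Rightarrow> nat) \<Rightarrow> bool"
  assumes finite_E: "finite E"
    and extend: "\<And>s e. P s \<Longrightarrow> s \<in> E \<rightarrow> {0..3} \<Longrightarrow> e \<in> E \<Longrightarrow> s e = 0 \<Longrightarrow> P (s(e := 1)) \<or> P (s(e := 2))"
    and "P s" and "s \<in> E \<rightarrow> {0..3}"
  shows "\<exists>t \<in> E \<rightarrow> {1..3}. P t \<and> (\<forall>e\<in>E. s e \<in> {0, t e})"
  using assms(3,4)
proof (induction "card {e \<in> E. s e = 0}" arbitrary: s)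
  case 0
  then have "{e \<in> E. s e = 0} = {}" using finite_E by simp
  then have "s \<in> E \<rightarrow> {1..3}" using "0.prems"(2) by (fastforce simp: Pi_iff)
  then show ?case using "0.prems"(1) by blast
next
  case (Suc n)
  then obtain e where e: "e \<in> E" "s e = 0"
    by (metis (mono_tags, lifting) Collect_empty_eq card.empty nat.distinct(1))
  obtain i where i: "i \<in> {1, 2}" "P (s(e := i))"
    using extend[OF Suc.prems e] by auto
  have eq: "{d \<in> E. s d = 0} = insert e {d \<in> E. (s(e := i)) d = 0}" using e i by auto
  have "card {d \<in> E. s d = 0} = Suc (card {d \<in> E. (s(e := i)) d = 0})"
    unfolding eq by (rule card_insert_disjoint) (use i finite_E in auto)
  then have "n = card {d \<in> E. (s(e := i)) d = 0}"
    using Suc.hyps(2) by linarith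
  moreover have "s(e := i) \<in> E \<rightarrow> {0..3}" using Suc.prems(2) i(1) by auto
  ultimately obtain t where t: "t \<in> E \<rightarrow> {1..3}" "P t" "\<forall>d\<in>E. (s(e := i)) d \<in> {0, t d}"
    using Suc.hyps(1)[of "s(e := i)"] i(2) by auto
  have "\<forall>d\<in>E. s d \<in> {0, t d}" using t(3) e(2) by (metis fun_upd_apply insertI1)
  then show ?case using t by blast
qed

text \<open>
  The number of occurrences of label \<open>3\<close> can be lowered: the condition on \<open>P\<close> says that, among the
  three transversals that differ at \<open>e\<close>, the number satisfying \<open>P\<close> is zero or two, so the value at
  \<open>3\<close> follows from the values at \<open>1\<close> and \<open>2\<close>.
\<close>
lemma transversals_determined:
  fixes P Q :: "('a \<Rightarrow> nat) \<Rightarrow> bool"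
  assumes finite_E: "finite E"
    and P: "\<And>t e. t \<in> E \<rightarrow> {1..3} \<Longrightarrow> e \<in> E \<Longrightarrow> P (t(e := 3)) \<longleftrightarrow> P (t(e := 1)) \<noteq> P (t(e := 2))"
    and Q: "\<And>t e. t \<in> E \<rightarrow> {1..3} \<Longrightarrow> e \<in> E \<Longrightarrow> Q (t(e := 3)) \<longleftrightarrow> Q (t(e := 1)) \<noteq> Q (t(e := 2))"
    and agree: "\<And>t. t \<in> E \<rightarrow> {1..2} \<Longrightarrow> P t \<longleftrightarrow> Q t"
    and t: "t \<in> E \<rightarrow> {1..3}"
  shows "P t \<longleftrightarrow> Q t"
  using t
proof (induction "card {e \<in> E. t e = 3}" arbitrary: t)
  case 0
  then have "{e \<in> E. t e = 3} = {}" using finite_E by simp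
  then have "t \<in> E \<rightarrow> {1..2}" using "0.prems" by (fastforce simp: Pi_iff)
  then show ?case by (rule agree)
next
  case (Suc n)
  then obtain e where e: "e \<in> E" "t e = 3"
    by (metis (mono_tags, lifting) Collect_empty_eq card.empty nat.distinct(1))
  have IH: "P (t(e := i)) \<longleftrightarrow> Q (t(e := i))" if i: "i \<in> {1, 2}" for i
  proof (rule Suc.hyps(1))
    have eq: "{d \<in> E. t d = 3} = insert e {d \<in> E. (t(e := i)) d = 3}" using e i by auto
    have "card {d \<in> E. t d = 3} = Suc (card {d \<in> E. (t(e := i)) d = 3})"
      unfolding eq by (rule card_insert_disjoint) (use i finite_E in auto)
    then show "n = card {d \<in> E. (t(e := i)) d = 3}" using Suc.hyps(2) by linarith
    show "t(e := i) \<in> E \<rightarrow> {1..3}" using Suc.prems i by auto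
  qed
  have "t = t(e := 3)" using e(2) by auto
  then show ?case using P[OF Suc.prems e(1)] Q[OF Suc.prems e(1)] IH[of 1] IH[of 2] by auto
qed

section \<open>Isotropic systems\<close>

text \<open>
  Here \<open>L\<close> plays the role of a space of linear relations between vectors attached to the elements
  of the skew classes, so the property is linear independence of the selected vectors.
\<close>
definition relation_free :: "'a set \<Rightarrow> ('a \<Rightarrow> nat) set \<Rightarrow> ('a \<Rightarrow> nat) \<Rightarrow> bool" where
  "relation_free E L s \<longleftrightarrow> (\<forall>v\<in>L. (\<forall>e\<in>E. v e \<in> {0, s e}) \<longrightarrow> (\<forall>e\<in>E. v e = 0))"

lemma relation_freeD:
  assumes "relation_free E L s" "v \<in> L" "\<And>e. e \<in> E \<Longrightarrow> v e \<in> {0, s e}" "d \<in> E"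
  shows "v d = 0"
  using assms unfolding relation_free_def by simp

lemma relation_free_cong:
  assumes "\<And>e. e \<in> E \<Longrightarrow> s e = t e"
  shows "relation_free E L s \<longleftrightarrow> relation_free E L t"
  unfolding relation_free_def using assms by simp

text \<open>
  Two nonzero vectors of the plane over the two-element field have symplectic product \<open>1\<close> exactly
  when they differ; \<open>isotropic\<close> therefore says that members of \<open>L\<close> are orthogonal for the sum of
  these products.  The assumption \<open>large\<close> is the consequence of \<open>L\<close> having dimension \<open>|E|\<close> that is
  needed: the \<open>|E| - 1\<close> linear conditions of lying below \<open>t\<close> outside \<open>e\<close> have a nonzero common
  solution.
\<close>
locale isotropic_system =
  fixes E :: "'a set" and L :: "('a \<Rightarrow> nat) set"
  assumes finite_E: "finite E"
    and labels: "v \<in> L \<Longrightarrow> v \<in> E \<rightarrow> {0..3}"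
    and isotropic: "v \<in> L \<Longrightarrow> w \<in> L \<Longrightarrow> even (card {e \<in> E. v e \<noteq> 0 \<and> w e \<noteq> 0 \<and> v e \<noteq> w e})"
    and large: "e \<in> E \<Longrightarrow> t \<in> E \<rightarrow> {1..3} \<Longrightarrow>
      \<exists>v\<in>L. (\<exists>d\<in>E. v d \<noteq> 0) \<and> (\<forall>d\<in>E - {e}. v d \<in> {0, t d})"
begin

lemma relation_free_mono:
  assumes "relation_free E L s" and "\<And>e. e \<in> E \<Longrightarrow> r e \<in> {0, s e}"
  shows "relation_free E L r"
  using assms unfolding relation_free_def by (metis empty_iff insert_iff)

text \<open>
  Otherwise there are two relations whose labels at \<open>e\<close> are \<open>i\<close> and \<open>j\<close> and which lie below the same
  \<open>s\<close> elsewhere.  Their symplectic product has its only nonzero term at \<open>e\<close>, against isotropy.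
\<close>
lemma relation_free_extend:
  assumes s: "relation_free E L s" "e \<in> E" and ij: "i \<noteq> j" "i \<noteq> 0" "j \<noteq> 0"
  shows "relation_free E L (s(e := i)) \<or> relation_free E L (s(e := j))"
proof (rule ccontr)
  assume neg: "\<not> ?thesis"
  have meets: "\<exists>v\<in>L. (\<forall>d\<in>E - {e}. v d \<in> {0, s d}) \<and> v e = k" if k: "\<not> relation_free E L (s(e := k))" for k
  proof -
    from k obtain v where v: "v \<in> L" "\<forall>d\<in>E. v d \<in> {0, (s(e := k)) d}" "\<exists>d\<in>E. v d \<noteq> 0"
      unfolding relation_free_def by blast
    have off: "\<forall>d\<in>E - {e}. v d \<in> {0, s d}" using v(2) by auto
    have "v e \<noteq> 0"
      using s(1) v(1,3) off unfolding relation_free_def by (metis DiffI insertI1 singletonD)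
    moreover have "v e \<in> {0, k}" using v(2) s(2) by fastforce
    ultimately have "v e = k" by simp
    then show ?thesis using v(1) off by (intro bexI[of _ v] conjI)
  qed
  obtain v w where v: "v \<in> L" "\<forall>d\<in>E - {e}. v d \<in> {0, s d}" "v e = i"
    and w: "w \<in> L" "\<forall>d\<in>E - {e}. w d \<in> {0, s d}" "w e = j"
    using neg meets[of i] meets[of j] by blast
  have off: "v d = 0 \<or> w d = 0 \<or> v d = w d" if "d \<in> E" "d \<noteq> e" for d
    using bspec[OF v(2), of d] bspec[OF w(2), of d] that by auto
  have "{d \<in> E. v d \<noteq> 0 \<and> w d \<noteq> 0 \<and> v d \<noteq> w d} = {e}" (is "?X = {e}")
  proof
    show "?X \<subseteq> {e}"
    proof
      fix d assume "d \<in> ?X"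
      then show "d \<in> {e}" using off[of d] by auto
    qed
    show "{e} \<subseteq> ?X" using v(3) w(3) ij s(2) by simp
  qed
  then show False using isotropic[OF v(1) w(1)] by simp
qed

text \<open>
  The relation supplied by \<open>large\<close> lies below the transversal whose label at \<open>e\<close> is its own.
\<close>
lemma not_all_relation_free:
  assumes e: "e \<in> E" and t: "t \<in> E \<rightarrow> {1..3}"
  shows "\<exists>i\<in>{1..3}. \<not> relation_free E L (t(e := i))"
proof -
  obtain v where v: "v \<in> L" "\<exists>d\<in>E. v d \<noteq> 0" "\<forall>d\<in>E - {e}. v d \<in> {0, t d}"
    using large[OF e t] by blast
  \<comment> \<open>If the relation vanishes at \<open>e\<close>, it lies below all three transversals and any label will do.\<close>
  define i where "i = (if v e = 0 then 1 else v e)"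
  have "i \<in> {1..3}" using labels[OF v(1)] e by (auto simp: i_def Pi_iff)
  moreover have "\<not> relation_free E L (t(e := i))"
    unfolding relation_free_def using v by (auto simp: i_def)
  ultimately show ?thesis by blast
qed

text \<open>
  If \<open>t\<close> with \<open>e\<close> erased contains a relation, so do all three transversals.  If not, at most one of the
  three contains a relation by \<open>relation_free_extend\<close>, and at least one does by
  \<open>not_all_relation_free\<close>.
\<close>
lemma relation_free_third:
  assumes e: "e \<in> E" and t: "t \<in> E \<rightarrow> {1..3}"
  shows "relation_free E L (t(e := 3)) \<longleftrightarrow> relation_free E L (t(e := 1)) \<noteq> relation_free E L (t(e := 2))"
proof (cases "relation_free E L (t(e := 0))")
  case True
  have two: "relation_free E L (t(e := i)) \<or> relation_free E L (t(e := j))" if "i \<noteq> j" "i \<noteq> 0" "j \<noteq> 0" for i j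
    using relation_free_extend[OF True e that] by simp
  have "{1..3} = {1, 2, 3::nat}" by auto
  then have "\<not> (relation_free E L (t(e := 1)) \<and> relation_free E L (t(e := 2)) \<and> relation_free E L (t(e := 3)))"
    using not_all_relation_free[OF e t] by auto
  then show ?thesis using two[of 1 2] two[of 1 3] two[of 2 3] by auto
next
  case False
  have "\<not> relation_free E L (t(e := i))" for i
  proof
    assume "relation_free E L (t(e := i))"
    then have "relation_free E L (t(e := 0))" by (rule relation_free_mono) auto
    with False show False ..
  qed
  then show ?thesis by blast
qed

end

section \<open>Tight 3-matroids with labelled elements\<close>

definition selection :: "'a set \<Rightarrow> ('a \<Rightarrow> nat \<Rightarrow> 'u) \<Rightarrow> ('a \<Rightarrow> nat) \<Rightarrow> 'u set" where
  "selection E el s = (\<lambda>e. el e (s e)) ` {e \<in> E. s e \<noteq> 0}"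

lemma selection_cong:
  assumes "\<And>e. e \<in> E \<Longrightarrow> s e = t e"
  shows "selection E el s = selection E el t"
  unfolding selection_def using assms by (intro image_cong Collect_cong conj_cong) simp_all

locale labelled_tight_three_matroid =
  fixes E :: "'a set" and el :: "'a \<Rightarrow> nat \<Rightarrow> 'u" and Z :: "'u multimatroid"
  assumes finite_E: "finite E"
    and labelling: "labelling E el"
    and elements: "elements Z = (\<Union>e\<in>E. skew_class el e)"
    and classes: "skew_classes Z = skew_class el ` E"
    and tight: "tight_three_matroid Z"
begin

abbreviation sel :: "('a \<Rightarrow> nat) \<Rightarrow> 'u set" where
  "sel \<equiv> selection E el"

lemma atLeastAtMost_1_3: "{1..3} = {1, 2, 3::nat}"
  by auto

lemma skew_class_image: "skew_class el e = el e ` {1..3}"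
  unfolding skew_class_def atLeastAtMost_1_3 by simp

lemma el_eq_iff:
  assumes "e \<in> E" "d \<in> E" "i \<in> {1..3}" "j \<in> {1..3}"
  shows "el e i = el d j \<longleftrightarrow> e = d \<and> i = j"
  using inj_on_eq_iff[OF labelling[unfolded labelling_def], of "(e, i)" "(d, j)"] assms
  unfolding atLeastAtMost_1_3 by simp

lemma el_mem_sel:
  assumes "s \<in> E \<rightarrow> {0..3}" "e \<in> E" "i \<in> {1..3}"
  shows "el e i \<in> sel s \<longleftrightarrow> s e = i"
proof
  assume "el e i \<in> sel s"
  then obtain d where d: "d \<in> E" "s d \<noteq> 0" "el e i = el d (s d)" by (auto simp: selection_def)
  then have "s d \<in> {1..3}" using assms(1) by (fastforce simp: Pi_iff)
  then show "s e = i" using d el_eq_iff[of e d i "s d"] assms by simp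
next
  assume "s e = i"
  then show "el e i \<in> sel s" using assms by (auto simp: selection_def)
qed

lemma sel_Int_skew_class:
  assumes "s \<in> E \<rightarrow> {0..3}" "e \<in> E"
  shows "sel s \<inter> skew_class el e = (if s e = 0 then {} else {el e (s e)})"
proof -
  have "s e \<in> {0..3}" using assms by auto
  then show ?thesis
    using el_mem_sel[OF assms] unfolding skew_class_image by auto
qed

lemma sel_subset_elements:
  assumes "s \<in> E \<rightarrow> {0..3}"
  shows "sel s \<subseteq> elements Z"
proof
  fix x assume "x \<in> sel s"
  then obtain e where e: "e \<in> E" "s e \<noteq> 0" "x = el e (s e)" by (auto simp: selection_def)
  then have "s e \<in> {1..3}" using assms by (fastforce simp: Pi_iff)
  then show "x \<in> elements Z" using e unfolding elements skew_class_image by blast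
qed

lemma sel_subset_iff:
  assumes "r \<in> E \<rightarrow> {0..3}" "s \<in> E \<rightarrow> {0..3}"
  shows "sel r \<subseteq> sel s \<longleftrightarrow> (\<forall>e\<in>E. r e \<in> {0, s e})"
proof
  assume sub: "sel r \<subseteq> sel s"
  show "\<forall>e\<in>E. r e \<in> {0, s e}"
  proof
    fix e assume e: "e \<in> E"
    show "r e \<in> {0, s e}"
    proof (cases "r e = 0")
      case False
      then have r: "r e \<in> {1..3}" using assms(1) e by (fastforce simp: Pi_iff)
      then have "el e (r e) \<in> sel r" using el_mem_sel[OF assms(1) e r] by simp
      then have "s e = r e" using sub el_mem_sel[OF assms(2) e r] by auto
      then show ?thesis by simp
    qed simp
  qed
next
  assume "\<forall>e\<in>E. r e \<in> {0, s e}"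
  then show "sel r \<subseteq> sel s" by (fastforce simp: selection_def)
qed

lemma subtransversal_sel:
  assumes "s \<in> E \<rightarrow> {0..3}"
  shows "subtransversal Z (sel s)"
  unfolding subtransversal_def classes
  using sel_subset_elements[OF assms] sel_Int_skew_class[OF assms] by auto

lemma transversal_sel:
  assumes "t \<in> E \<rightarrow> {1..3}"
  shows "transversal Z (sel t)"
proof -
  have t: "t \<in> E \<rightarrow> {0..3}" using assms by fastforce
  have "t e \<noteq> 0" if "e \<in> E" for e using funcset_mem[OF assms that] by simp
  then show ?thesis
    unfolding transversal_def classes
    using sel_subset_elements[OF t] sel_Int_skew_class[OF t] by auto
qed

text \<open>
  The encoding by label functions is onto: a class is met at most once, so testing the labels
  \<open>1, 2, 3\<close> in turn finds the selected element.
\<close>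
lemma subtransversal_obtains_sel:
  assumes S: "subtransversal Z S"
  obtains s where "s \<in> E \<rightarrow> {0..3}" "S = sel s"
proof
  define s where "s = (\<lambda>e. if el e 1 \<in> S then 1 else if el e 2 \<in> S then 2
    else if el e 3 \<in> S then 3 else 0 :: nat)"
  show s: "s \<in> E \<rightarrow> {0..3}" by (auto simp: s_def)
  have fin: "finite (S \<inter> skew_class el e)" for e by (simp add: skew_class_def)
  have uniq: "i = j" if e: "e \<in> E" and "i \<in> {1..3}" "j \<in> {1..3}" "el e i \<in> S" "el e j \<in> S" for e i j
  proof -
    have "card (S \<inter> skew_class el e) \<le> 1" using S e by (simp add: subtransversal_def classes)
    then have "el e i = el e j"
      using that by (intro card_le_Suc0_iff_eq[OF fin, THEN iffD1, rule_format])
        (auto simp: skew_class_image)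
    then show ?thesis using el_eq_iff that by simp
  qed
  show "S = sel s"
  proof
    show "S \<subseteq> sel s"
    proof
      fix x assume x: "x \<in> S"
      then have "x \<in> elements Z" using S by (auto simp: subtransversal_def)
      then obtain e i where ei: "e \<in> E" "i \<in> {1..3}" "x = el e i"
        unfolding elements skew_class_image by blast
      from ei x have mem: "el e i \<in> S" by simp
      from ei(2) consider "i = 1" | "i = 2" | "i = 3" by fastforce
      then have "s e = i"
      proof cases
        case 1
        then show ?thesis using mem by (simp add: s_def)
      next
        case 2
        then show ?thesis using mem uniq[OF ei(1), of 1 2] by (auto simp: s_def)
      next
        case 3
        then show ?thesis using mem uniq[OF ei(1), of 1 3] uniq[OF ei(1), of 2 3] by (auto simp: s_def)
      qed
      then show "x \<in> sel s" using el_mem_sel[OF s ei(1,2)] ei(3) by simp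
    qed
    show "sel s \<subseteq> S"
      by (auto simp: selection_def s_def split: if_splits)
  qed
qed

lemma multimatroid: "is_multimatroid Z"
  using tight by (simp add: tight_three_matroid_def three_matroid_def)

lemma indep_subtransversal: "I \<in> indep Z \<Longrightarrow> subtransversal Z I"
  using multimatroid by (simp add: is_multimatroid_def)

lemma sel_fun_upd:
  assumes "s \<in> E \<rightarrow> {0..3}" "e \<in> E" "i \<noteq> 0"
  shows "sel (s(e := i)) = insert (el e i) (sel s - skew_class el e)"
proof -
  have "sel s - skew_class el e = (\<lambda>e. el e (s e)) ` {d \<in> E - {e}. s d \<noteq> 0}"
  proof
    show "sel s - skew_class el e \<subseteq> (\<lambda>e. el e (s e)) ` {d \<in> E - {e}. s d \<noteq> 0}"
    proof
      fix x assume x: "x \<in> sel s - skew_class el e"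
      then obtain d where d: "d \<in> E" "s d \<noteq> 0" "x = el d (s d)" by (auto simp: selection_def)
      then have "s d \<in> {1..3}" using assms(1) by (fastforce simp: Pi_iff)
      then have "d \<noteq> e" using x d(3) by (auto simp: skew_class_image)
      then show "x \<in> (\<lambda>e. el e (s e)) ` {d \<in> E - {e}. s d \<noteq> 0}" using d by auto
    qed
    show "(\<lambda>e. el e (s e)) ` {d \<in> E - {e}. s d \<noteq> 0} \<subseteq> sel s - skew_class el e"
    proof
      fix x assume "x \<in> (\<lambda>e. el e (s e)) ` {d \<in> E - {e}. s d \<noteq> 0}"
      then obtain d where d: "d \<in> E" "d \<noteq> e" "s d \<noteq> 0" "x = el d (s d)" by auto
      then have "s d \<in> {1..3}" using assms(1) by (fastforce simp: Pi_iff)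
      then have "x \<notin> skew_class el e"
        using d el_eq_iff[OF d(1) assms(2)] unfolding skew_class_image by (metis imageE)
      then show "x \<in> sel s - skew_class el e" using d by (auto simp: selection_def)
    qed
  qed
  moreover have "sel (s(e := i)) = insert (el e i) ((\<lambda>e. el e (s e)) ` {d \<in> E - {e}. s d \<noteq> 0})"
    using assms(2,3) by (auto simp: selection_def)
  ultimately show ?thesis by simp
qed

lemma indep_extend:
  assumes "sel s \<in> indep Z" "s \<in> E \<rightarrow> {0..3}" "e \<in> E" "s e = 0"
  shows "sel (s(e := 1)) \<in> indep Z \<or> sel (s(e := 2)) \<in> indep Z"
proof -
  have disj: "sel s \<inter> skew_class el e = {}" using sel_Int_skew_class assms by simp
  have "el e 1 \<noteq> el e 2" using el_eq_iff[of e e 1 2] assms(3) by simp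
  moreover have "el e 1 \<in> skew_class el e" "el e 2 \<in> skew_class el e"
    by (auto simp: skew_class_def)
  ultimately have "insert (el e 1) (sel s) \<in> indep Z \<or> insert (el e 2) (sel s) \<in> indep Z"
    using multimatroid assms(1,3) disj unfolding is_multimatroid_def classes
    by (metis Int_commute imageI)
  moreover have "sel s - skew_class el e = sel s" using disj by blast
  ultimately show ?thesis using sel_fun_upd[OF assms(2,3)] by simp
qed

lemma indep_extend_transversal:
  assumes "sel s \<in> indep Z" "s \<in> E \<rightarrow> {0..3}"
  shows "\<exists>t \<in> E \<rightarrow> {1..3}. sel t \<in> indep Z \<and> (\<forall>e\<in>E. s e \<in> {0, t e})"
  by (rule extend_to_transversal[OF finite_E, where P = "\<lambda>s. sel s \<in> indep Z"])
    (use assms indep_extend in auto)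

text \<open>
  The matroid axioms of \<open>Z\<close> speak only of independent sets inside a fixed transversal, so closure
  under subsets needs a transversal around the given set first.
\<close>
lemma indep_subset:
  assumes I: "I \<in> indep Z" and J: "J \<subseteq> I"
  shows "J \<in> indep Z"
proof -
  obtain s where s: "s \<in> E \<rightarrow> {0..3}" "I = sel s"
    using subtransversal_obtains_sel[OF indep_subtransversal[OF I]] .
  obtain t where t: "t \<in> E \<rightarrow> {1..3}" "\<forall>e\<in>E. s e \<in> {0, t e}"
    using indep_extend_transversal I s by meson
  have "t \<in> E \<rightarrow> {0..3}" using t(1) by fastforce
  then have "I \<in> indep Z \<inter> Pow (sel t)" using I s t(2) sel_subset_iff by simp
  moreover have "matroid_on (sel t) (indep Z \<inter> Pow (sel t))"
    using multimatroid transversal_sel[OF t(1)] by (simp add: is_multimatroid_def)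
  ultimately show ?thesis using J unfolding matroid_on_def by blast
qed

text \<open>
  An independent transversal is maximal because every independent set is a subtransversal.
\<close>
lemma basis_sel_iff:
  assumes t: "t \<in> E \<rightarrow> {1..3}"
  shows "basis Z (sel t) \<longleftrightarrow> sel t \<in> indep Z"
proof
  assume ind: "sel t \<in> indep Z"
  have "I = sel t" if I: "I \<in> indep Z" "sel t \<subseteq> I" for I
  proof -
    obtain s where s: "s \<in> E \<rightarrow> {0..3}" "I = sel s"
      using subtransversal_obtains_sel[OF indep_subtransversal[OF I(1)]] .
    have "t \<in> E \<rightarrow> {0..3}" using t by fastforce
    then have "\<forall>e\<in>E. t e \<in> {0, s e}" using sel_subset_iff s I(2) by simp
    moreover have "t e \<noteq> 0" if "e \<in> E" for e using funcset_mem[OF t that] by simp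
    ultimately have "\<forall>e\<in>E. t e = s e" by fastforce
    then show ?thesis unfolding s(2) selection_def by (intro image_cong) auto
  qed
  then show "basis Z (sel t)" using ind unfolding basis_def by blast
qed (simp add: basis_def)

text \<open>
  If one of the three transversals is a basis, tightness leaves exactly one non-basis, hence exactly
  two bases; otherwise there is none.  This is \<open>relation_free_third\<close> for the bases of \<open>Z\<close>.
\<close>
lemma indep_third:
  assumes t: "t \<in> E \<rightarrow> {1..3}" and e: "e \<in> E"
  shows "sel (t(e := 3)) \<in> indep Z \<longleftrightarrow> (sel (t(e := 1)) \<in> indep Z) \<noteq> (sel (t(e := 2)) \<in> indep Z)"
proof (cases "\<exists>i\<in>{1..3}. sel (t(e := i)) \<in> indep Z")
  case True
  then obtain i where i: "i \<in> {1..3}" "sel (t(e := i)) \<in> indep Z" by blast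
  have basis: "basis Z (sel (t(e := j))) \<longleftrightarrow> sel (t(e := j)) \<in> indep Z" if "j \<in> {1..3}" for j
    using t that by (intro basis_sel_iff) auto
  have ti: "t(e := i) \<in> E \<rightarrow> {0..3}" using t i(1) by fastforce
  have ins: "insert (el e j) (sel (t(e := i)) - skew_class el e) = sel (t(e := j))"
    if "j \<in> {1..3}" for j
    using sel_fun_upd[OF ti e, of j] that by simp
  have "\<exists>!u. u \<in> skew_class el e \<and> \<not> basis Z (insert u (sel (t(e := i)) - skew_class el e))"
    using tight basis[OF i(1)] i(2) e unfolding tight_three_matroid_def classes by blast
  then obtain v where v: "v \<in> skew_class el e \<and>
      \<not> basis Z (insert v (sel (t(e := i)) - skew_class el e))"
    and unique: "\<forall>u. u \<in> skew_class el e \<and>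
      \<not> basis Z (insert u (sel (t(e := i)) - skew_class el e)) \<longrightarrow> u = v"
    by (rule ex1E)
  from v obtain j where j: "j \<in> {1..3}" "v = el e j" unfolding skew_class_image by blast
  have j_dep: "sel (t(e := j)) \<notin> indep Z"
    using v unfolding j(2) ins[OF j(1)] basis[OF j(1)] by simp
  have indep: "sel (t(e := k)) \<in> indep Z" if k: "k \<in> {1..3}" "k \<noteq> j" for k
  proof (rule ccontr)
    assume "sel (t(e := k)) \<notin> indep Z"
    then have "el e k = v"
      using unique[rule_format, of "el e k"] k(1) ins[OF k(1)] basis[OF k(1)]
        imageI[OF k(1), of "el e", folded skew_class_image] by simp
    then show False using el_eq_iff[OF e e k(1) j(1)] j(2) k(2) by simp
  qed
  from j(1) consider "j = 1" | "j = 2" | "j = 3" by fastforce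
  then show ?thesis using j_dep indep[of 1] indep[of 2] indep[of 3] by cases auto
next
  case False
  then show ?thesis by (simp add: atLeastAtMost_1_3)
qed

text \<open>
  A transversal of \<open>Z\<close> that avoids \<open>T\<^sub>3\<close> cannot be enlarged in \<open>Z\<close>, let alone in \<open>Z - T\<^sub>3\<close>.
\<close>
lemma basis_delete_iff:
  assumes t: "t \<in> E \<rightarrow> {1..2}"
  shows "basis (delete Z (tau E el 3)) (sel t) \<longleftrightarrow> sel t \<in> indep Z"
proof
  assume ind: "sel t \<in> indep Z"
  have t': "t \<in> E \<rightarrow> {1..3}" "t \<in> E \<rightarrow> {0..3}"
    by (rule subsetD[OF Pi_mono t]; simp)+
  have "sel t \<inter> tau E el 3 = {}"
  proof -
    have "el e 3 \<notin> sel t" if "e \<in> E" for e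
      using el_mem_sel[OF t'(2) that, of 3] funcset_mem[OF t that] by auto
    then show ?thesis by (auto simp: tau_def)
  qed
  then have "sel t \<in> indep (delete Z (tau E el 3))"
    using ind sel_subset_elements[OF t'(2)] by (auto simp: delete_def)
  then show "basis (delete Z (tau E el 3)) (sel t)"
    using basis_sel_iff[OF t'(1)] ind by (simp add: basis_def delete_def)
qed (simp add: basis_def delete_def)

lemma feasible_iff:
  assumes "F \<subseteq> E"
  shows "F \<in> feasible (set_system_of E el Z) \<longleftrightarrow> sel (\<lambda>e. if e \<in> F then 2 else 1) \<in> indep Z"
proof -
  let ?t = "\<lambda>e. if e \<in> F then 2 else 1"
  have "sel ?t = (\<lambda>e. el e (?t e)) ` ((E - F) \<union> F)"
    using assms unfolding selection_def by (intro arg_cong2[where f = image]) auto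
  also have "\<dots> = (\<lambda>e. el e 1) ` (E - F) \<union> (\<lambda>e. el e 2) ` F"
    unfolding image_Un by (intro arg_cong2[where f = "(\<union>)"] image_cong) auto
  also have "\<dots> = {el e 1 |e. e \<in> E - F} \<union> {el e 2 |e. e \<in> F}"
    by (simp only: Setcompr_eq_image)
  finally have "{el e 1 |e. e \<in> E - F} \<union> {el e 2 |e. e \<in> F} = sel ?t" ..
  then show ?thesis
    using assms basis_delete_iff[of "\<lambda>e. if e \<in> F then 2 else 1"] by (simp add: set_system_of_def)
qed

lemma dependent_contains_circuit:
  assumes "subtransversal Z S" "S \<notin> indep Z"
  shows "\<exists>C\<subseteq>S. circuit Z C"
proof -
  let ?A = "{C. C \<subseteq> S \<and> subtransversal Z C \<and> C \<notin> indep Z}"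
  have "finite S"
    using finite_subset[of S "elements Z"] assms(1) multimatroid
    by (simp add: subtransversal_def is_multimatroid_def)
  then have "finite ?A" by simp
  moreover have "S \<in> ?A" using assms by simp
  ultimately have "\<exists>C\<in>?A. \<forall>B\<in>?A. B \<subseteq> C \<longrightarrow> C = B"
    by (intro finite_has_minimal) blast+
  then obtain C where C: "C \<in> ?A" and minimal: "\<forall>B\<in>?A. B \<subseteq> C \<longrightarrow> C = B" ..
  have "C' \<in> indep Z" if C': "C' \<subset> C" "subtransversal Z C'" for C'
  proof (rule ccontr)
    assume "C' \<notin> indep Z"
    then have "C' \<in> ?A" using C' C by auto
    then show False using minimal C'(1) by blast
  qed
  then have "circuit Z C" using C unfolding circuit_def by simp
  then show ?thesis using C by blast
qed

lemma card_sel_Int_tau_3: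
  assumes s: "s \<in> E \<rightarrow> {0..3}"
  shows "card (sel s \<inter> tau E el 3) = card {e \<in> E. s e = 3}"
proof -
  have "sel s \<inter> tau E el 3 = (\<lambda>e. el e 3) ` {e \<in> E. s e = 3}"
    using el_mem_sel[OF s, of _ 3] by (auto simp: tau_def)
  moreover have "inj_on (\<lambda>e. el e 3) {e \<in> E. s e = 3}"
    using el_eq_iff[of _ _ 3 3] by (intro inj_onI) simp
  ultimately show ?thesis by (simp add: card_image)
qed

end

section \<open>Circuits of a 3-matroid that comes from an isotropic system\<close>

context labelled_tight_three_matroid
begin

text \<open>
  Agreement on the transversals avoiding \<open>T\<^sub>3\<close> propagates to all transversals, and through
  extension to transversals to all subtransversals: the dependent ones are those that contain a
  nonzero relation.  Minimality then forces a circuit to equal the support of such a relation.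
\<close>
lemma circuit_in_isotropic_system:
  assumes iso: "isotropic_system E L"
    and agree: "\<And>F. F \<subseteq> E \<Longrightarrow> sel (\<lambda>e. if e \<in> F then 2 else 1) \<in> indep Z \<longleftrightarrow>
      relation_free E L (\<lambda>e. if e \<in> F then 2 else 1)"
    and C: "circuit Z C"
  shows "\<exists>v\<in>L. C = sel v"
proof -
  interpret isotropic_system E L by (rule iso)
  have transversals: "sel t \<in> indep Z \<longleftrightarrow> relation_free E L t" if "t \<in> E \<rightarrow> {1..3}" for t
  proof (rule transversals_determined[OF finite_E indep_third relation_free_third _ that])
    fix t :: "'a \<Rightarrow> nat" assume t: "t \<in> E \<rightarrow> {1..2}"
    let ?F = "{e \<in> E. t e = 2}"
    let ?t = "\<lambda>e. if e \<in> ?F then 2 else 1"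
    have eq: "t e = ?t e" if "e \<in> E" for e using funcset_mem[OF t that] that by auto
    have "sel t = sel ?t" by (rule selection_cong) (rule eq)
    moreover have "relation_free E L t \<longleftrightarrow> relation_free E L ?t" by (rule relation_free_cong) (rule eq)
    ultimately show "sel t \<in> indep Z \<longleftrightarrow> relation_free E L t" using agree[of ?F] by simp
  qed
  obtain s where s: "s \<in> E \<rightarrow> {0..3}" "C = sel s"
    using subtransversal_obtains_sel C unfolding circuit_def by blast
  have "\<not> relation_free E L s"
  proof
    assume s_free: "relation_free E L s"
    have extend: "relation_free E L (r(e := 1)) \<or> relation_free E L (r(e := 2))"
      if "relation_free E L r" "r \<in> E \<rightarrow> {0..3}" "e \<in> E" "r e = 0" for r e
      using relation_free_extend[OF that(1,3), of 1 2] by simp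
    obtain t where t: "t \<in> E \<rightarrow> {1..3}" "relation_free E L t" "\<forall>e\<in>E. s e \<in> {0, t e}"
      using extend_to_transversal[of E "relation_free E L", OF finite_E extend s_free s(1)] by blast
    have "t \<in> E \<rightarrow> {0..3}" by (rule subsetD[OF Pi_mono t(1)]) simp
    then have "C \<subseteq> sel t" using sel_subset_iff[OF s(1)] t(3) s(2) by simp
    then show False using indep_subset transversals[OF t(1)] t(2) C unfolding circuit_def by blast
  qed
  then obtain v where v: "v \<in> L" "\<forall>e\<in>E. v e \<in> {0, s e}" "\<exists>e\<in>E. v e \<noteq> 0"
    unfolding relation_free_def by blast
  have v_labels: "v \<in> E \<rightarrow> {0..3}" using labels[OF v(1)] .
  have "sel v \<notin> indep Z"
  proof
    assume "sel v \<in> indep Z"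
    then obtain t where t: "t \<in> E \<rightarrow> {1..3}" "sel t \<in> indep Z" "\<forall>e\<in>E. v e \<in> {0, t e}"
      using indep_extend_transversal[OF _ v_labels] by blast
    then have t_free: "relation_free E L t" using transversals by simp
    obtain d where d: "d \<in> E" "v d \<noteq> 0" using v(3) by blast
    have "v d = 0" using relation_freeD[OF t_free v(1) bspec[OF t(3)] d(1)] .
    with d(2) show False ..
  qed
  moreover have "sel v \<subseteq> C" using sel_subset_iff[OF v_labels s(1)] v(2) s(2) by simp
  ultimately have "sel v = C"
    using C subtransversal_sel[OF v_labels] unfolding circuit_def by blast
  then show ?thesis using v(1) by blast
qed

end

section \<open>Adjacent feasible sets and odd circuits\<close>

lemma even_card_sym_diff_singleton:
  assumes "finite X"
  shows "even (card (sym_diff X {u})) \<longleftrightarrow> odd (card X)"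
proof (cases "u \<in> X")
  case True
  then have "sym_diff X {u} = X - {u}" by auto
  moreover have "card X = Suc (card (X - {u}))" using card.remove[OF assms True] .
  ultimately show ?thesis by simp
next
  case False
  then have "sym_diff X {u} = insert u X" by auto
  then show ?thesis using False assms by simp
qed

text \<open>
  Take feasible \<open>X\<close>, \<open>Y\<close> of different parity at minimal distance and exchange at some \<open>u\<close>.  A partner
  \<open>v \<noteq> u\<close> would preserve the parity of \<open>X\<close> and bring it closer to \<open>Y\<close>, so \<open>v = u\<close>, and \<open>X\<close> and
  \<open>X \<triangle> {u}\<close> are adjacent.
\<close>
lemma adjacent_feasible_sets:
  assumes dm: "delta_matroid D" and not_even: "\<not> even_set_system D"
  shows "\<exists>F u. F \<in> feasible D \<and> u \<in> ground D - F \<and> insert u F \<in> feasible D"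
proof -
  note dm' = dm[unfolded delta_matroid_def]
  have ground: "F \<subseteq> ground D" "finite F" if "F \<in> feasible D" for F
    using conjunct1[OF conjunct2[OF dm']] conjunct1[OF dm'] that
    by (blast intro: finite_subset)+
  note exchange = conjunct2[OF conjunct2[OF conjunct2[OF dm']], rule_format]
  have "?thesis" if "X \<in> feasible D" "Y \<in> feasible D" "even (card X) \<noteq> even (card Y)" for X Y
    using that
  proof (induction "card (sym_diff X Y)" arbitrary: X rule: less_induct)
    case less
    have "X \<noteq> Y" using less.prems(3) by blast
    then obtain u where u: "u \<in> sym_diff X Y" by blast
    then obtain v where v: "v \<in> sym_diff X Y" "sym_diff X {u, v} \<in> feasible D"
      using exchange[OF less.prems(1,2) u] by (elim bexE)
    show ?case
    proof (cases "u = v")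
      case True
      show ?thesis
      proof (cases "u \<in> X")
        case u_in: True
        then have eq: "sym_diff X {u, v} = X - {u}" using True by auto
        have "X - {u} \<in> feasible D" using v(2) by (simp only: eq)
        moreover have "insert u (X - {u}) = X" using u_in by auto
        moreover have "u \<in> ground D" using ground(1)[OF less.prems(1)] u_in by auto
        ultimately show ?thesis
          using less.prems(1) by (intro exI[of _ "X - {u}"] exI[of _ u]) simp
      next
        case u_notin: False
        then have eq: "sym_diff X {u, v} = insert u X" using True by auto
        have "insert u X \<in> feasible D" using v(2) by (simp only: eq)
        moreover from this have "u \<in> ground D" using ground(1) by auto
        ultimately show ?thesis
          using less.prems(1) u_notin by (intro exI[of _ X] exI[of _ u]) simp
      qed
    next
      case False
      let ?X = "sym_diff X {u, v}"
      have "?X = sym_diff (sym_diff X {u}) {v}" using False by auto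
      then have parity: "even (card ?X) \<longleftrightarrow> even (card X)"
        using even_card_sym_diff_singleton[of "sym_diff X {u}" v]
          even_card_sym_diff_singleton[of X u] ground(2)[OF less.prems(1)] by simp
      have "sym_diff ?X Y \<subset> sym_diff X Y" using u v(1) by blast
      then have "card (sym_diff ?X Y) < card (sym_diff X Y)"
        using ground(2)[OF less.prems(1)] ground(2)[OF less.prems(2)] by (intro psubset_card_mono) auto
      then show ?thesis using less.hyps[of ?X] v(2) less.prems(2,3) parity by simp
    qed
  qed
  then show ?thesis using not_even unfolding even_set_system_def by blast
qed

context labelled_tight_three_matroid
begin

text \<open>
  Adjacent feasible sets use up the two bases in the class of \<open>u\<close>, so the transversal through
  \<open>el u 3\<close> is dependent.  Without \<open>el u 3\<close> it is part of a basis, which is why each circuit in it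
  contains \<open>el u 3\<close>.
\<close>
lemma odd_circuit_if_not_even:
  assumes dm: "delta_matroid (set_system_of E el Z)"
    and odd: "\<not> even_set_system (set_system_of E el Z)"
  shows "\<exists>C. circuit Z C \<and> card (C \<inter> tau E el 3) = 1"
proof -
  have ground: "ground (set_system_of E el Z) = E" by (simp add: set_system_of_def)
  obtain F u where F: "F \<in> feasible (set_system_of E el Z)" "u \<in> E" "u \<notin> F"
    "insert u F \<in> feasible (set_system_of E el Z)"
    using adjacent_feasible_sets[OF dm odd] ground by auto
  have sub: "F \<subseteq> E" using F(1) by (simp add: set_system_of_def)
  define t where "t = (\<lambda>e. if e \<in> F then 2 else 1 :: nat)"
  have t: "t \<in> E \<rightarrow> {1..3}" "t \<in> E \<rightarrow> {0..3}" by (auto simp: t_def)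
  have t1: "t(u := 1) = t" and t2: "t(u := 2) = (\<lambda>e. if e \<in> insert u F then 2 else 1)"
    using F(3) by (auto simp: t_def)
  have indep: "sel t \<in> indep Z" using feasible_iff[OF sub] F(1) by (simp add: t_def)
  have "sel (t(u := 2)) \<in> indep Z"
    using feasible_iff[of "insert u F"] sub F(2,4) by (simp only: t2) simp
  then have "sel (t(u := 3)) \<notin> indep Z" using indep_third[OF t(1) F(2)] indep t1 by simp
  moreover have t3: "t(u := 3) \<in> E \<rightarrow> {0..3}" using t(2) by auto
  ultimately obtain C where C: "C \<subseteq> sel (t(u := 3))" "circuit Z C"
    using dependent_contains_circuit[OF subtransversal_sel] by blast
  have "el u 3 \<in> C"
  proof (rule ccontr)
    assume "el u 3 \<notin> C"
    then have "C \<subseteq> sel t" using C(1) sel_fun_upd[OF t(2) F(2), of 3] by auto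
    then show False using indep_subset[OF indep] C(2) by (simp add: circuit_def)
  qed
  moreover have "C \<inter> tau E el 3 \<subseteq> {el u 3}"
  proof
    fix x assume x: "x \<in> C \<inter> tau E el 3"
    then obtain e where e: "e \<in> E" "x = el e 3" by (auto simp: tau_def)
    then have "(t(u := 3)) e = 3" using el_mem_sel[OF t3 e(1), of 3] C(1) x by auto
    then show "x \<in> {el u 3}" using e(2) by (auto simp: t_def split: if_splits)
  qed
  moreover have "el u 3 \<in> tau E el 3" using F(2) by (auto simp: tau_def)
  ultimately have "C \<inter> tau E el 3 = {el u 3}" by blast
  then show ?thesis using C(2) by auto
qed

end

section \<open>Binary delta-matroids in terms of kernels\<close>

text \<open>
  Arithmetic on bits is used as arithmetic of a field; rewriting it into bit operations would hide
  sums and products from the algebraic simplification rules.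
\<close>
declare add_bit_eq_xor [simp del] mult_bit_eq_and [simp del]

text \<open>
  Nonsingularity of a principal submatrix, stated through its kernel so that the index set can be
  any finite set.
\<close>
definition nonsingular_on :: "('a \<Rightarrow> 'a \<Rightarrow> bit) \<Rightarrow> 'a set \<Rightarrow> bool" where
  "nonsingular_on a G \<longleftrightarrow> (\<forall>y. (\<forall>i\<in>G. (\<Sum>j\<in>G. a i j * y j) = 0) \<longrightarrow> (\<forall>i\<in>G. y i = 0))"

lemma nonsingular_on_reindex:
  assumes f: "bij_betw f G H"
  shows "nonsingular_on (\<lambda>i j. b (f i) (f j)) G \<longleftrightarrow> nonsingular_on b H"
proof
  assume b: "nonsingular_on b H"
  show "nonsingular_on (\<lambda>i j. b (f i) (f j)) G"
    unfolding nonsingular_on_def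
  proof (intro allI impI ballI)
    fix y i assume y: "\<forall>i\<in>G. (\<Sum>j\<in>G. b (f i) (f j) * y j) = 0" and i: "i \<in> G"
    define z where "z = (\<lambda>h. y (inv_into G f h))"
    have z: "z (f j) = y j" if "j \<in> G" for j
      using f that by (simp add: z_def bij_betw_def)
    have "(\<Sum>h\<in>H. b k h * z h) = 0" if k: "k \<in> H" for k
    proof -
      obtain g where g: "g \<in> G" "k = f g" using f k unfolding bij_betw_def by blast
      have "(\<Sum>h\<in>H. b k h * z h) = (\<Sum>j\<in>G. b (f g) (f j) * z (f j))"
        using sum.reindex_bij_betw[OF f, of "\<lambda>h. b k h * z h"] g(2) by simp
      also have "\<dots> = (\<Sum>j\<in>G. b (f g) (f j) * y j)" using z by simp
      finally show ?thesis using y g(1) by simp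
    qed
    then have "\<forall>h\<in>H. z h = 0" using b unfolding nonsingular_on_def by blast
    then show "y i = 0" using z[OF i] bij_betwE[OF f] i by simp
  qed
next
  assume a: "nonsingular_on (\<lambda>i j. b (f i) (f j)) G"
  show "nonsingular_on b H"
    unfolding nonsingular_on_def
  proof (intro allI impI ballI)
    fix y h assume y: "\<forall>i\<in>H. (\<Sum>j\<in>H. b i j * y j) = 0" and h: "h \<in> H"
    have "(\<Sum>j\<in>G. b (f i) (f j) * y (f j)) = 0" if "i \<in> G" for i
      using sum.reindex_bij_betw[OF f, of "\<lambda>h. b (f i) h * y h"] y bij_betwE[OF f] that by simp
    then have "\<forall>i\<in>G. y (f i) = 0"
      using a[unfolded nonsingular_on_def, rule_format, of "\<lambda>i. y (f i)"] by blast
    then show "y h = 0" using f h unfolding bij_betw_def by blast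
  qed
qed

lemma bij_betw_pick:
  assumes "finite Y"
  shows "bij_betw (pick Y) {..<card Y} Y"
proof -
  have inj: "inj_on (pick Y) {..<card Y}"
    by (rule inj_onI) (metis lessThan_iff linorder_neqE_nat pick_mono_le less_irrefl)
  moreover have "pick Y ` {..<card Y} \<subseteq> Y" using pick_in_set_le by auto
  moreover have "card (pick Y ` {..<card Y}) = card Y" using card_image[OF inj] by simp
  ultimately show ?thesis using card_subset_eq[OF assms] by (simp add: bij_betw_def)
qed

lemma det_ne_0_iff_nonsingular_on:
  assumes M: "M \<in> carrier_mat k k"
  shows "det M \<noteq> 0 \<longleftrightarrow> nonsingular_on (\<lambda>i j. M $$ (i, j)) {..<k}"
proof -
  have mult: "(M *\<^sub>v v) $ i = (\<Sum>j<k. M $$ (i, j) * v $ j)"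
    if "v \<in> carrier_vec k" "i < k" for v i
    using M that by (simp add: scalar_prod_def atLeast0LessThan)
  have "det M = 0 \<longleftrightarrow> \<not> nonsingular_on (\<lambda>i j. M $$ (i, j)) {..<k}"
    unfolding det_0_iff_vec_prod_zero_field[OF M]
  proof
    assume "\<exists>v. v \<in> carrier_vec k \<and> v \<noteq> 0\<^sub>v k \<and> M *\<^sub>v v = 0\<^sub>v k"
    then obtain v where v: "v \<in> carrier_vec k" "v \<noteq> 0\<^sub>v k" "M *\<^sub>v v = 0\<^sub>v k" by blast
    then have "\<exists>i<k. v $ i \<noteq> 0" by (auto simp: vec_eq_iff)
    moreover have "\<forall>i<k. (\<Sum>j<k. M $$ (i, j) * v $ j) = 0"
      using mult[OF v(1)] v(3) by simp
    ultimately show "\<not> nonsingular_on (\<lambda>i j. M $$ (i, j)) {..<k}"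
      unfolding nonsingular_on_def by auto
  next
    assume "\<not> nonsingular_on (\<lambda>i j. M $$ (i, j)) {..<k}"
    then obtain y i where y: "\<forall>i<k. (\<Sum>j<k. M $$ (i, j) * y j) = 0" "i < k" "y i \<noteq> 0"
      unfolding nonsingular_on_def by auto
    have "M *\<^sub>v vec k y = 0\<^sub>v k"
      using M y(1) mult[of "vec k y"] by (intro eq_vecI) auto
    moreover have "vec k y \<noteq> 0\<^sub>v k" using y(2,3) by (metis index_vec index_zero_vec(1))
    ultimately show "\<exists>v. v \<in> carrier_vec k \<and> v \<noteq> 0\<^sub>v k \<and> M *\<^sub>v v = 0\<^sub>v k"
      by (intro exI[of _ "vec k y"]) simp
  qed
  then show ?thesis by blast
qed

lemma feasible_delta_matroid_of_mat:
  assumes A: "A \<in> carrier_mat n n" and Y: "Y \<subseteq> {0..<n}"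
  shows "Y \<in> feasible (delta_matroid_of_mat A) \<longleftrightarrow> nonsingular_on (\<lambda>i j. A $$ (i, j)) Y"
proof -
  have fin: "finite Y" using Y finite_subset by blast
  have rows: "{i. i < n \<and> i \<in> Y} = Y" using Y by auto
  have dim: "submatrix A Y Y \<in> carrier_mat (card Y) (card Y)"
    using A by (intro carrier_matI) (simp_all add: dim_submatrix rows)
  have entries: "submatrix A Y Y $$ (i, j) = A $$ (pick Y i, pick Y j)"
    if "i < card Y" "j < card Y" for i j
    using submatrix_index[of i A Y j Y] A that by (simp add: rows)
  have "det (submatrix A Y Y) \<noteq> 0 \<longleftrightarrow>
      nonsingular_on (\<lambda>i j. A $$ (pick Y i, pick Y j)) {..<card Y}"
    unfolding det_ne_0_iff_nonsingular_on[OF dim] nonsingular_on_def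
    by (simp add: entries)
  also have "\<dots> \<longleftrightarrow> nonsingular_on (\<lambda>i j. A $$ (i, j)) Y"
    using nonsingular_on_reindex[OF bij_betw_pick[OF fin], of "\<lambda>i j. A $$ (i, j)"] .
  finally show ?thesis using A Y by (simp add: delta_matroid_of_mat_def)
qed

text \<open>
  The isomorphism is absorbed into the indexing of the matrix and the twist into the symmetric
  difference, so that everything takes place on the ground set of \<open>D\<close>.
\<close>
lemma binary_representation:
  assumes "binary_delta_matroid D"
  obtains X a where "X \<subseteq> ground D" "\<And>i j. i \<in> ground D \<Longrightarrow> j \<in> ground D \<Longrightarrow> a i j = a j i"
    "\<And>F. F \<subseteq> ground D \<Longrightarrow> F \<in> feasible D \<longleftrightarrow> nonsingular_on a (sym_diff F X)"
proof -
  let ?E = "ground D"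
  obtain X n and A :: "bit mat" where X: "X \<subseteq> ?E" and A: "A \<in> carrier_mat n n" "transpose_mat A = A"
    and iso: "set_system_iso (twist D X) (delta_matroid_of_mat A)"
    using assms unfolding binary_delta_matroid_def by blast
  have feas: "feasible D \<subseteq> Pow ?E"
    using assms by (simp add: binary_delta_matroid_def delta_matroid_def)
  obtain f where f: "bij_betw f ?E {0..<n}"
    and img: "feasible (delta_matroid_of_mat A) = (\<lambda>F. f ` F) ` (\<lambda>F. sym_diff F X) ` feasible D"
    using iso A(1) unfolding set_system_iso_def by (auto simp: twist_def delta_matroid_of_mat_def)
  show ?thesis
  proof
    show "X \<subseteq> ?E" by (rule X)
    show "A $$ (f i, f j) = A $$ (f j, f i)" if "i \<in> ?E" "j \<in> ?E" for i j
    proof -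
      have "f i < n" "f j < n" using bij_betwE[OF f] that by auto
      then show ?thesis using A by (metis carrier_matD index_transpose_mat(1))
    qed
    fix F assume F: "F \<subseteq> ?E"
    let ?G = "sym_diff F X"
    have G: "?G \<subseteq> ?E" using F X by blast
    have "f ` ?G \<subseteq> {0..<n}" using f G unfolding bij_betw_def by blast
    note matrix = feasible_delta_matroid_of_mat[OF A(1) this]
    have "F \<in> feasible D \<longleftrightarrow> f ` ?G \<in> feasible (delta_matroid_of_mat A)"
    proof
      assume "f ` ?G \<in> feasible (delta_matroid_of_mat A)"
      then obtain F' where F': "F' \<in> feasible D" "f ` ?G = f ` sym_diff F' X"
        unfolding img by blast
      have "sym_diff F' X \<subseteq> ?E" using F'(1) feas X by blast
      then have "?G = sym_diff F' X"
        using inj_on_image_eq_iff[of f ?E] f G F'(2) unfolding bij_betw_def by blast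
      then have "F = F'" by blast
      then show "F \<in> feasible D" using F'(1) by simp
    qed (auto simp: img)
    moreover have "bij_betw f ?G (f ` ?G)"
      using f G by (meson bij_betw_def inj_on_subset)
    ultimately show "F \<in> feasible D \<longleftrightarrow> nonsingular_on (\<lambda>i j. A $$ (f i, f j)) ?G"
      using matrix nonsingular_on_reindex[of f ?G "f ` ?G" "\<lambda>i j. A $$ (i, j)"] by simp
  qed
qed

section \<open>The isotropic system of a twisted symmetric matrix\<close>

text \<open>
  The labels \<open>1\<close>, \<open>2\<close>, \<open>3\<close> name the vectors \<open>(1, 0)\<close>, \<open>(0, 1)\<close>, \<open>(1, 1)\<close>.
\<close>
definition pair_label :: "bit \<Rightarrow> bit \<Rightarrow> nat" where
  "pair_label p q = (if p = 0 then if q = 0 then 0 else 2 else if q = 0 then 1 else 3)"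

lemma of_nat_bit_eq_0_iff: "(of_nat k :: bit) = 0 \<longleftrightarrow> even k"
proof (induction k)
  case (Suc k)
  then show ?case by (cases "of_nat k :: bit") simp_all
qed simp

text \<open>
  Over the two-element field, the symplectic product of two vectors of the plane detects whether
  they are linearly independent, that is, nonzero and distinct.
\<close>
lemma symplectic_pair_label:
  "of_bool (pair_label p q \<noteq> 0 \<and> pair_label r s \<noteq> 0 \<and> pair_label p q \<noteq> pair_label r s) = p * s + q * r"
  by (cases p; cases q; cases r; cases s) (auto simp: pair_label_def)

locale symmetric_bit_form =
  fixes E :: "'a set" and a :: "'a \<Rightarrow> 'a \<Rightarrow> bit" and X :: "'a set"
  assumes finite_E: "finite E" and X: "X \<subseteq> E"
    and sym: "i \<in> E \<Longrightarrow> j \<in> E \<Longrightarrow> a i j = a j i"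
begin

definition apply_form :: "('a \<Rightarrow> bit) \<Rightarrow> 'a \<Rightarrow> bit" where
  "apply_form y i = (\<Sum>j\<in>E. a i j * y j)"

text \<open>
  The identity \<open>A y + A y = 0\<close>, read as a linear relation between the columns of \<open>(I | A | I + A)\<close>: the
  coefficient of the unit vector of \<open>e\<close> is \<open>(A y)\<^sub>e\<close> and that of column \<open>e\<close> of \<open>A\<close> is \<open>y\<^sub>e\<close>; if both
  are \<open>1\<close>, the two are merged into column \<open>e\<close> of \<open>I + A\<close>.  Twisting by \<open>X\<close> exchanges the first two
  elements of the classes in \<open>X\<close>.
\<close>
definition relation :: "('a \<Rightarrow> bit) \<Rightarrow> 'a \<Rightarrow> nat" where
  "relation y e = (if e \<in> X then pair_label (y e) (apply_form y e) else pair_label (apply_form y e) (y e))"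

lemma apply_form_add: "apply_form (\<lambda>i. y i + z i) i = apply_form y i + apply_form z i"
  by (simp add: apply_form_def distrib_left sum.distrib)

lemma apply_form_symmetric: "(\<Sum>i\<in>E. y i * apply_form z i) = (\<Sum>i\<in>E. apply_form y i * z i)"
proof -
  have "(\<Sum>i\<in>E. y i * apply_form z i) = (\<Sum>i\<in>E. \<Sum>j\<in>E. y i * (a i j * z j))"
    by (simp add: apply_form_def sum_distrib_left)
  also have "\<dots> = (\<Sum>j\<in>E. \<Sum>i\<in>E. y i * (a i j * z j))" by (rule sum.swap)
  also have "\<dots> = (\<Sum>j\<in>E. \<Sum>i\<in>E. a j i * y i * z j)"
    by (intro sum.cong refl) (simp add: sym mult.assoc mult.left_commute)
  also have "\<dots> = (\<Sum>j\<in>E. apply_form y j * z j)"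
    by (simp add: apply_form_def sum_distrib_right)
  finally show ?thesis .
qed

text \<open>
  The symplectic product of \<open>(A y, y)\<close> and \<open>(A z, z)\<close> is \<open>y\<^sup>T A z + (A y)\<^sup>T z\<close>, and both summands
  agree since \<open>A\<close> is symmetric.  Exchanging coordinates on \<open>X\<close> does not affect the form.
\<close>
lemma relations_isotropic:
  "even (card {e \<in> E. relation y e \<noteq> 0 \<and> relation z e \<noteq> 0 \<and> relation y e \<noteq> relation z e})"
    (is "even (card {e \<in> E. ?P e})")
proof -
  have "(of_nat (card {e \<in> E. ?P e}) :: bit) = (\<Sum>e\<in>E. of_bool (?P e))"
    using finite_E by (simp add: sum.If_cases of_bool_def Int_def)
  also have "\<dots> = (\<Sum>e\<in>E. y e * apply_form z e + apply_form y e * z e)"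
    by (intro sum.cong refl) (simp only: relation_def symplectic_pair_label split: if_split, simp add: ac_simps)
  also have "\<dots> = (\<Sum>e\<in>E. apply_form y e * z e) + (\<Sum>e\<in>E. apply_form y e * z e)"
    by (simp add: sum.distrib apply_form_symmetric)
  also have "\<dots> = 0" by (cases "\<Sum>e\<in>E. apply_form y e * z e") simp_all
  finally show ?thesis by (simp only: of_nat_bit_eq_0_iff)
qed

text \<open>
  The linear functional of \<open>y\<close> whose kernel consists of those \<open>y\<close> for which \<open>relation y\<close> has label \<open>0\<close>
  or \<open>i\<close> at \<open>e\<close>.
\<close>
definition label_defect :: "nat \<Rightarrow> ('a \<Rightarrow> bit) \<Rightarrow> 'a \<Rightarrow> bit" where
  "label_defect i y e = (if i = 3 then apply_form y e + y e else if (i = 1) = (e \<in> X) then apply_form y e else y e)"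

lemma label_defect_add: "label_defect i (\<lambda>d. y d + z d) e = label_defect i y e + label_defect i z e"
  by (simp add: label_defect_def apply_form_add ac_simps)

lemma relation_mem_iff:
  assumes "i \<in> {1..3}"
  shows "relation y e \<in> {0, i} \<longleftrightarrow> label_defect i y e = 0"
proof -
  from assms consider "i = 1" | "i = 2" | "i = 3" by fastforce
  then show ?thesis
    by cases (cases "apply_form y e"; cases "y e"; simp add: label_defect_def relation_def pair_label_def)+
qed

lemma relation_eq_0_iff: "relation y e = 0 \<longleftrightarrow> y e = 0 \<and> apply_form y e = 0"
  by (auto simp: relation_def pair_label_def)

text \<open>
  A dimension count in the form of the pigeonhole principle: the \<open>|E| - 1\<close> functionals
  \<open>label_defect\<close> take at most \<open>2 ^ (|E| - 1)\<close> joint values on the \<open>2 ^ |E|\<close> indicator vectors, so two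
  different ones have the same values, and their sum is a nonzero common zero.
\<close>
lemma relations_large:
  assumes e: "e \<in> E" and t: "t \<in> E \<rightarrow> {1..3}"
  shows "\<exists>y. (\<exists>d\<in>E. relation y d \<noteq> 0) \<and> (\<forall>d\<in>E - {e}. relation y d \<in> {0, t d})"
proof -
  define h where "h Y = {d \<in> E - {e}. label_defect (t d) (\<lambda>i. of_bool (i \<in> Y)) d \<noteq> 0}" for Y
  have "card (Pow (E - {e})) < card (Pow E)"
    using e finite_E by (intro psubset_card_mono) auto
  moreover have "card (h ` Pow E) \<le> card (Pow (E - {e}))"
    using finite_E by (intro card_mono) (auto simp: h_def)
  ultimately have "\<not> inj_on h (Pow E)" using card_image[of h "Pow E"] by linarith
  then obtain Y Y' where Y: "Y \<subseteq> E" "Y' \<subseteq> E" "Y \<noteq> Y'" "h Y = h Y'"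
    unfolding inj_on_def by blast
  define y :: "'a \<Rightarrow> bit" where "y i = of_bool (i \<in> Y) + of_bool (i \<in> Y')" for i
  obtain d where d: "d \<in> E" "(d \<in> Y) \<noteq> (d \<in> Y')" using Y by blast
  then have "y d \<noteq> 0" by (auto simp: y_def)
  then have "relation y d \<noteq> 0" by (simp add: relation_eq_0_iff)
  moreover have "relation y d \<in> {0, t d}" if d: "d \<in> E - {e}" for d
  proof -
    have "label_defect (t d) (\<lambda>i. of_bool (i \<in> Y)) d \<noteq> 0 \<longleftrightarrow> label_defect (t d) (\<lambda>i. of_bool (i \<in> Y')) d \<noteq> 0"
      using Y(4) d unfolding h_def by blast
    then have "label_defect (t d) y d = 0"
      unfolding y_def label_defect_add
      by (cases "label_defect (t d) (\<lambda>i. of_bool (i \<in> Y)) d"; cases "label_defect (t d) (\<lambda>i. of_bool (i \<in> Y')) d") simp_all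
    then show ?thesis using relation_mem_iff t d by blast
  qed
  ultimately show ?thesis using d(1) by blast
qed

sublocale isotropic_system E "range relation"
proof
  show "finite E" by (rule finite_E)
  show "v \<in> E \<rightarrow> {0..3}" if "v \<in> range relation" for v
    using that by (auto simp: relation_def pair_label_def)
  show "even (card {e \<in> E. v e \<noteq> 0 \<and> w e \<noteq> 0 \<and> v e \<noteq> w e})"
    if "v \<in> range relation" "w \<in> range relation" for v w
    using that relations_isotropic by auto
  show "\<exists>v\<in>range relation. (\<exists>d\<in>E. v d \<noteq> 0) \<and> (\<forall>d\<in>E - {e}. v d \<in> {0, t d})"
    if "e \<in> E" "t \<in> E \<rightarrow> {1..3}" for e t
    using relations_large[OF that] by blast
qed

text \<open>
  For a transversal avoiding \<open>T\<^sub>3\<close> the relations below it are the vectors \<open>y\<close> that vanish outside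
  \<open>F \<triangle> X\<close> and have \<open>A y = 0\<close> on \<open>F \<triangle> X\<close>, which is the kernel of that principal submatrix.
\<close>
lemma relation_free_iff_nonsingular_on:
  assumes F: "F \<subseteq> E"
  shows "relation_free E (range relation) (\<lambda>e. if e \<in> F then 2 else 1) \<longleftrightarrow> nonsingular_on a (sym_diff F X)"
proof -
  define G where "G = sym_diff F X"
  let ?t = "\<lambda>e. if e \<in> F then 2 else 1 :: nat"
  have G: "G \<subseteq> E" unfolding G_def using F X by blast
  have apply_form_G: "apply_form y i = (\<Sum>j\<in>G. a i j * y j)" if "\<forall>e\<in>E - G. y e = 0" for y i
    unfolding apply_form_def using that finite_E G by (intro sum.mono_neutral_right) auto
  have below: "(\<forall>e\<in>E. relation y e \<in> {0, ?t e}) \<longleftrightarrow>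
      (\<forall>e\<in>E - G. y e = 0) \<and> (\<forall>e\<in>G. apply_form y e = 0)" for y
  proof -
    have "relation y e \<in> {0, ?t e} \<longleftrightarrow> (if e \<in> G then apply_form y e = 0 else y e = 0)" for e
      using relation_mem_iff[of "?t e" y e] by (auto simp: label_defect_def G_def)
    then show ?thesis using G by auto
  qed
  \<comment> \<open>A relation is zero only if \<open>y\<close> is, because \<open>A y\<close> is determined by \<open>y\<close>.\<close>
  have zero: "(\<forall>e\<in>E. relation y e = 0) \<longleftrightarrow> (\<forall>e\<in>E. y e = 0)" for y
    by (auto simp: relation_eq_0_iff apply_form_def)
  show ?thesis
    unfolding G_def[symmetric]
  proof
    assume free: "relation_free E (range relation) ?t"
    show "nonsingular_on a G"
      unfolding nonsingular_on_def
    proof (intro allI impI)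
      fix y assume y: "\<forall>i\<in>G. (\<Sum>j\<in>G. a i j * y j) = 0"
      define z where "z i = (if i \<in> G then y i else 0)" for i
      have off: "\<forall>e\<in>E - G. z e = 0" by (simp add: z_def)
      have "apply_form z i = (\<Sum>j\<in>G. a i j * y j)" for i
        unfolding apply_form_G[OF off] by (intro sum.cong) (simp_all add: z_def)
      then have "\<forall>e\<in>E. relation z e \<in> {0, ?t e}" using y off below by simp
      then have "\<forall>e\<in>E. z e = 0" using free zero unfolding relation_free_def by blast
      then show "\<forall>i\<in>G. y i = 0" using G by (metis subsetD z_def)
    qed
  next
    assume ns: "nonsingular_on a G"
    show "relation_free E (range relation) ?t"
      unfolding relation_free_def
    proof (intro ballI impI)
      fix v e assume "v \<in> range relation" and v: "\<forall>e\<in>E. v e \<in> {0, ?t e}" and e: "e \<in> E"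
      then obtain y where y: "v = relation y" by blast
      have off: "\<forall>e\<in>E - G. y e = 0" and on: "\<forall>e\<in>G. apply_form y e = 0"
        using v below unfolding y by blast+
      have "\<forall>i\<in>G. y i = 0" using ns on unfolding nonsingular_on_def apply_form_G[OF off] by blast
      then have "\<forall>e\<in>E. y e = 0" using off by blast
      then show "v e = 0" using zero e unfolding y by blast
    qed
  qed
qed

text \<open>
  Off the diagonal, the terms at \<open>(i, j)\<close> and \<open>(j, i)\<close> are equal and cancel.
\<close>
lemma alternating_quadratic_form_eq_0:
  assumes diag: "\<And>e. e \<in> E \<Longrightarrow> a e e = 0"
  shows "(\<Sum>i\<in>E. y i * apply_form y i) = 0"
proof -
  have "(\<Sum>i\<in>S. \<Sum>j\<in>S. y i * (a i j * y j)) = 0" if "finite S" "S \<subseteq> E" for S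
    using that
  proof (induction S)
    case (insert x S)
    have "(\<Sum>i\<in>S. y i * (a i x * y x)) = (\<Sum>j\<in>S. y x * (a x j * y j))"
      using insert.prems by (intro sum.cong refl) (auto simp: sym[of _ x] ac_simps)
    then have "(\<Sum>i\<in>insert x S. \<Sum>j\<in>insert x S. y i * (a i j * y j)) =
        (\<Sum>j\<in>S. y x * (a x j * y j)) + (\<Sum>j\<in>S. y x * (a x j * y j))"
      using insert diag[of x] by (simp add: sum.distrib)
    also have "\<dots> = 0" by (cases "\<Sum>j\<in>S. y x * (a x j * y j)") simp_all
    finally show ?case .
  qed simp
  from this[OF finite_E] show ?thesis by (simp add: apply_form_def sum_distrib_left)
qed

text \<open>
  The label at \<open>e\<close> is \<open>3\<close> exactly when \<open>y\<^sub>e (A y)\<^sub>e = 1\<close>, so the cardinality modulo \<open>2\<close> is \<open>y\<^sup>T A y\<close>.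
\<close>
lemma even_card_label_3:
  assumes "\<And>e. e \<in> E \<Longrightarrow> a e e = 0"
  shows "even (card {e \<in> E. relation y e = 3})"
proof -
  have "(of_nat (card {e \<in> E. relation y e = 3}) :: bit) = (\<Sum>e\<in>E. of_bool (relation y e = 3))"
    using finite_E by (simp add: sum.If_cases of_bool_def Int_def)
  also have "\<dots> = (\<Sum>e\<in>E. y e * apply_form y e)"
  proof (intro sum.cong refl)
    fix e show "(of_bool (relation y e = 3) :: bit) = y e * apply_form y e"
      by (cases "y e"; cases "apply_form y e") (simp_all add: relation_def pair_label_def)
  qed
  also have "\<dots> = 0" using alternating_quadratic_form_eq_0[OF assms] .
  finally show ?thesis by (simp only: of_nat_bit_eq_0_iff)
qed

end

section \<open>Parity of the circuits\<close>

text \<open>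
  The empty submatrix is nonsingular, so \<open>X\<close> is feasible.  A nonzero diagonal entry at \<open>e\<close> would make
  \<open>X \<triangle> {e}\<close> feasible as well, with the other parity.
\<close>
lemma zero_diagonal_if_even:
  assumes even: "even_set_system D"
    and D: "finite (ground D)" "X \<subseteq> ground D"
    and rep: "\<And>F. F \<subseteq> ground D \<Longrightarrow> F \<in> feasible D \<longleftrightarrow> nonsingular_on a (sym_diff F X)"
    and e: "e \<in> ground D"
  shows "a e e = 0"
proof (rule ccontr)
  assume diag: "a e e \<noteq> 0"
  have "X \<in> feasible D" using rep[OF D(2)] by (simp add: nonsingular_on_def)
  moreover have "sym_diff X {e} \<in> feasible D"
  proof -
    have "sym_diff (sym_diff X {e}) X = {e}" by blast
    moreover have "nonsingular_on a {e}"
      unfolding nonsingular_on_def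
    proof (intro allI impI)
      fix y assume "\<forall>i\<in>{e}. (\<Sum>j\<in>{e}. a i j * y j) = 0"
      then have "a e e * y e = 0" by simp
      then show "\<forall>i\<in>{e}. y i = 0" using diag by simp
    qed
    moreover have "sym_diff X {e} \<subseteq> ground D" using D(2) e by blast
    ultimately show ?thesis by (simp only: rep)
  qed
  ultimately have "even (card (sym_diff X {e})) \<longleftrightarrow> even (card X)"
    using even unfolding even_set_system_def by blast
  then show False
    using even_card_sym_diff_singleton[OF finite_subset[OF D(2,1)], of e] by simp
qed

theorem theorem3p1:
  fixes D :: "'a set_system" and el :: "'a \<Rightarrow> nat \<Rightarrow> 'u" and Z :: "'u multimatroid"
  assumes "binary_delta_matroid D"
    and "labelling (ground D) el"
    and "is_Z3 D el Z"
  shows "even_set_system D \<longleftrightarrow> (\<forall>C. circuit Z C \<longrightarrow> p3 (ground D) el C = 0)"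
proof -
  define E where "E = ground D"
  have dm: "delta_matroid D" using assms(1) by (simp add: binary_delta_matroid_def)
  then have finite: "finite E" by (simp add: delta_matroid_def E_def)
  have D_eq: "D = set_system_of E el Z" using assms(3) by (simp add: is_Z3_def E_def)
  interpret Z: labelled_tight_three_matroid E el Z
    using assms(2,3) finite by unfold_locales (simp_all add: is_Z3_def E_def)
  show ?thesis
    unfolding E_def[symmetric]
  proof
    assume even: "even_set_system D"
    obtain X a where X: "X \<subseteq> E" and sym: "\<And>i j. i \<in> E \<Longrightarrow> j \<in> E \<Longrightarrow> a i j = a j i"
      and rep: "\<And>F. F \<subseteq> E \<Longrightarrow> F \<in> feasible D \<longleftrightarrow> nonsingular_on a (sym_diff F X)"
      using binary_representation[OF assms(1)] unfolding E_def by metis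
    interpret symmetric_bit_form E a X by unfold_locales (fact finite X sym)+
    have diag: "a e e = 0" if "e \<in> E" for e
      by (rule zero_diagonal_if_even[OF even finite[unfolded E_def] X[unfolded E_def]
            _ that[unfolded E_def]]) (rule rep[unfolded E_def])
    have agree: "selection E el (\<lambda>e. if e \<in> F then 2 else 1) \<in> indep Z \<longleftrightarrow>
        relation_free E (range relation) (\<lambda>e. if e \<in> F then 2 else 1)" if "F \<subseteq> E" for F
      using Z.feasible_iff[OF that] rep[OF that] relation_free_iff_nonsingular_on[OF that] D_eq by simp
    show "\<forall>C. circuit Z C \<longrightarrow> p3 E el C = 0"
    proof (intro allI impI)
      fix C assume circuit: "circuit Z C"
      have "\<exists>v\<in>range relation. C = selection E el v"
        by (rule Z.circuit_in_isotropic_system[OF isotropic_system_axioms _ circuit]) (rule agree)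
      then obtain y where C: "C = selection E el (relation y)" by blast
      have "relation y \<in> E \<rightarrow> {0..3}" using labels by blast
      then have "card (C \<inter> tau E el 3) = card {e \<in> E. relation y e = 3}"
        unfolding C by (rule Z.card_sel_Int_tau_3)
      then show "p3 E el C = 0" using even_card_label_3[OF diag] by (simp add: p3_def even_iff_mod_2_eq_zero)
    qed
  next
    assume p3: "\<forall>C. circuit Z C \<longrightarrow> p3 E el C = 0"
    show "even_set_system D"
    proof (rule ccontr)
      assume "\<not> even_set_system D"
      then obtain C where "circuit Z C" "card (C \<inter> tau E el 3) = 1"
        using Z.odd_circuit_if_not_even[folded D_eq] dm by blast
      moreover from this have "p3 E el C = 1" by (simp add: p3_def)
      ultimately show False using p3 by auto
    qed
  qed
qed

end
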